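(* For every integer $n\ge 6$, $\gamma_f^\infty(KG_{n,2})=1+\frac{n-2}{n-4}=2+\frac{2}{n-4}=\frac{2n-6}{n-4}$.
   Context: The Kneser graph $KG_{n,k}$ is the graph whose vertices are all $k$-subsets of an $n$-set, two vertices being adjacent if and only if they are disjoint. $N(v)$ is the open neighbourhood and $N[v]=N(v)\cup\{v\}$ the closed neighbourhood of $v$. A fractional dominating function of a finite simple graph $G=(V,E)$ is a function $w:V\to[0,\infty)$ with $\sum_{x\in N[v]}w(x)\ge 1$ for all $v\in V$; its total weight is $\sum_{x\in V}w(x)$. Fractional eternal domination. Fix $S$. The defender chooses a fractional dominating function $w_1$ of total weight at most $S$. In each round $i\ge 1$ the attacker, who may choose attacks adaptively, attacks a vertex $v_i\in V$, and the defender chooses amounts $m_{xy,i}\ge 0$ for all $x\in V$, $y\in N(x)$, with $\sum_{y\in N(x)}m_{xy,i}\le w_i(x)$, and sets $w_{i+1}(x)=w_i(x)-\sum_{y\in N(x)}m_{xy,i}+\sum_{y\in N(x)}m_{yx,i}$. It is required that $w_{i+1}$ be a fractional dominating function and $w_{i+1}(v_i)\ge 1$. If the defender can respond in this way to every infinite sequence of attacks, $G$ can be eternally $S$-fractionally dominated. $\gamma_f^\infty(G)$ is the infimum of all $S$ for which $G$ can be eternally $S$-fractionally dominated. *)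

theory Defs
  imports "HOL-Analysis.Analysis" "Graph_Theory.Pair_Digraph"
begin

text \<open>
  A finite simple graph is a \<^locale>\<open>pair_graph\<close>: a finite vertex set \<^const>\<open>pverts\<close> with a
  symmetric irreflexive set \<^const>\<open>parcs\<close> of ordered pairs of adjacent vertices.
  Weights and moved amounts are total real-valued functions, of which only the values on
  vertices, respectively on ordered pairs of adjacent vertices, matter.
\<close>

definition open_nbhd :: "'a pair_pre_digraph \<Rightarrow> 'a \<Rightarrow> 'a set" where
  "open_nbhd G v = {u. (v, u) \<in> parcs G}"

definition closed_nbhd :: "'a pair_pre_digraph \<Rightarrow> 'a \<Rightarrow> 'a set" where
  "closed_nbhd G v = insert v (open_nbhd G v)"

definition kneser_graph :: "nat \<Rightarrow> nat \<Rightarrow> nat set pair_pre_digraph" where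
  "kneser_graph n k =
    \<lparr> pverts = {A. A \<subseteq> {1..n} \<and> card A = k},
      parcs = {(A, B). A \<subseteq> {1..n} \<and> card A = k \<and> B \<subseteq> {1..n} \<and> card B = k \<and> A \<inter> B = {}} \<rparr>"

text \<open>For \<open>k = 0\<close> the only vertex would be adjacent to itself.\<close>

lemma pair_graph_kneser_graph:
  assumes "k \<ge> 1"
  shows "pair_graph (kneser_graph n k)"
proof -
  have fin: "finite {A. A \<subseteq> {1..n} \<and> card A = k}"
    by (rule finite_subset[of _ "Pow {1..n}"]) auto
  let ?E = "{(A, B). A \<subseteq> {1..n} \<and> card A = k \<and> B \<subseteq> {1..n} \<and> card B = k \<and> A \<inter> B = {}}"
  have fin_arcs: "finite ?E"
    by (rule finite_subset[OF _ finite_cartesian_product[OF fin fin]]) blast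
  interpret pair_wf_digraph "kneser_graph n k"
    by unfold_locales (simp_all add: kneser_graph_def split_beta)
  show ?thesis
  proof unfold_locales
    show "finite (pverts (kneser_graph n k))" "finite (parcs (kneser_graph n k))"
      using fin fin_arcs by (simp_all add: kneser_graph_def)
    show "symmetric (with_proj (kneser_graph n k))"
      unfolding symmetric_def with_proj_simps
      by (rule symI) (simp add: kneser_graph_def Int_commute)
    fix e assume "e \<in> parcs (kneser_graph n k)"
    then have "card (fst e) \<ge> 1" "fst e \<inter> snd e = {}"
      using assms by (simp_all add: kneser_graph_def split_beta)
    then show "fst e \<noteq> snd e"
      by (metis Int_absorb card.empty not_one_le_zero)
  qed
qed

definition fractional_dominating :: "'a pair_pre_digraph \<Rightarrow> ('a \<Rightarrow> real) \<Rightarrow> bool" where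
  "fractional_dominating G w \<longleftrightarrow>
     (\<forall>x\<in>pverts G. w x \<ge> 0) \<and> (\<forall>v\<in>pverts G. (\<Sum>x\<in>closed_nbhd G v. w x) \<ge> 1)"

definition total_weight :: "'a pair_pre_digraph \<Rightarrow> ('a \<Rightarrow> real) \<Rightarrow> real" where
  "total_weight G w = (\<Sum>x\<in>pverts G. w x)"

definition legal_move ::
    "'a pair_pre_digraph \<Rightarrow> ('a \<Rightarrow> real) \<Rightarrow> ('a \<Rightarrow> 'a \<Rightarrow> real) \<Rightarrow> bool" where
  "legal_move G w m \<longleftrightarrow>
     (\<forall>x\<in>pverts G. \<forall>y\<in>open_nbhd G x. m x y \<ge> 0) \<and>
     (\<forall>x\<in>pverts G. (\<Sum>y\<in>open_nbhd G x. m x y) \<le> w x)"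

definition apply_move ::
    "'a pair_pre_digraph \<Rightarrow> ('a \<Rightarrow> real) \<Rightarrow> ('a \<Rightarrow> 'a \<Rightarrow> real) \<Rightarrow> ('a \<Rightarrow> real)" where
  "apply_move G w m x =
     w x - (\<Sum>y\<in>open_nbhd G x. m x y) + (\<Sum>y\<in>open_nbhd G x. m y x)"

text \<open>
  A strategy \<open>\<mu>\<close> of the defender maps the nonempty list of the attacks made so far, ending
  with the current one, to the amounts moved in response to the current attack.
  Attacks are numbered from \<open>0\<close>, and \<open>play G \<mu> w v i\<close> is the weight function after the
  responses to the attacks \<open>v 0, \<dots>, v (i - 1)\<close>.
\<close>

primrec play ::
    "'a pair_pre_digraph \<Rightarrow> ('a list \<Rightarrow> 'a \<Rightarrow> 'a \<Rightarrow> real) \<Rightarrow> ('a \<Rightarrow> real) \<Rightarrow> (nat \<Rightarrow> 'a) \<Rightarrow>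
     nat \<Rightarrow> 'a \<Rightarrow> real" where
  "play G \<mu> w v 0 = w"
| "play G \<mu> w v (Suc i) = apply_move G (play G \<mu> w v i) (\<mu> (map v [0..<Suc i]))"

text \<open>
  As the strategy sees only past attacks, quantifying over all attack sequences after fixing
  the strategy covers adaptive attackers.
\<close>

definition eternally_fractionally_dominable :: "'a pair_pre_digraph \<Rightarrow> real \<Rightarrow> bool" where
  "eternally_fractionally_dominable G S \<longleftrightarrow>
     (\<exists>w \<mu>. fractional_dominating G w \<and> total_weight G w \<le> S \<and>
        (\<forall>v. (\<forall>i. v i \<in> pverts G) \<longrightarrow>
           (\<forall>i. legal_move G (play G \<mu> w v i) (\<mu> (map v [0..<Suc i])) \<and>
                fractional_dominating G (play G \<mu> w v (Suc i)) \<and>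
                play G \<mu> w v (Suc i) (v i) \<ge> 1)))"

definition fractional_eternal_domination_number :: "'a pair_pre_digraph \<Rightarrow> real" where
  "fractional_eternal_domination_number G = Inf {S. eternally_fractionally_dominable G S}"

text \<open>The infimum is over a nonempty set of reals that is bounded below.\<close>

lemma eternally_fractionally_dominable_nonneg:
  assumes "eternally_fractionally_dominable G S"
  shows "S \<ge> 0"
proof -
  obtain w where "fractional_dominating G w" "total_weight G w \<le> S"
    using assms unfolding eternally_fractionally_dominable_def by blast
  moreover from this have "total_weight G w \<ge> 0"
    by (auto simp: fractional_dominating_def total_weight_def intro: sum_nonneg)
  ultimately show ?thesis by simp
qed

lemma eternally_fractionally_dominable_card:
  assumes "pair_graph G"
  shows "eternally_fractionally_dominable G (real (card (pverts G)))"
proof -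
  interpret pair_graph G by fact
  let ?w = "\<lambda>_. 1 :: real" and ?\<mu> = "\<lambda>_ _ _. 0 :: real"
  have play: "play G ?\<mu> ?w v i = ?w" for v i
    by (induction i) (auto simp: apply_move_def fun_eq_iff)
  have "open_nbhd G v \<subseteq> pverts G" for v
    by (auto simp: open_nbhd_def dest: in_arcsD2)
  then have "finite (closed_nbhd G v)" for v
    using pair_finite_verts finite_subset unfolding closed_nbhd_def by blast
  then have "card (closed_nbhd G v) > 0" for v
    by (simp add: card_gt_0_iff closed_nbhd_def)
  then have "real (card (closed_nbhd G v)) \<ge> 1" for v
    by (simp add: Suc_le_eq)
  then have "fractional_dominating G ?w"
    by (simp add: fractional_dominating_def)
  then show ?thesis
    unfolding eternally_fractionally_dominable_def
    by (intro exI[of _ ?w] exI[of _ ?\<mu>])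
      (simp only: play, simp add: legal_move_def total_weight_def)
qed

end

theory Submission
  imports Defs
begin

text \<open>
  Why the value is \<open>1 + (n - 2) / (n - 4)\<close>: a vertex of the graph is a pair in \<open>{1..n}\<close>, and
  after an attack on \<open>v\<close> one unit of weight must sit on \<open>v\<close>.  This unit helps to dominate \<open>v\<close>
  and the pairs disjoint from \<open>v\<close>, but none of the \<open>2 (n - 2)\<close> pairs that share exactly one element
  with \<open>v\<close>.  These have to be dominated by the rest of the weight.  A pair disjoint from \<open>v\<close>
  lies in the closed neighbourhoods of \<open>2 (n - 4)\<close> of them, a pair that meets \<open>v\<close> in one element
  in those of only \<open>n - 2\<close>, and \<open>n - 2 \<le> 2 (n - 4)\<close> because \<open>n \<ge> 6\<close>.  By double counting, the rest
  weighs at least \<open>2 (n - 2) / (2 (n - 4))\<close>.  A move does not change the total weight, so one attack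
  already forces the lower bound (\<open>kneser_dominable_lower_bound\<close>).

  Equality suggests to keep, besides the unit on \<open>v\<close>, a constant amount \<open>share n\<close> on every pair
  disjoint from \<open>v\<close> and nothing elsewhere (\<open>guard_config\<close>).  Its total weight is the lower bound, and
  \<open>share n\<close> is such that the \<open>(n - 3) choose 2\<close> pairs disjoint from two intersecting pairs carry
  exactly one unit, so that the configuration is dominating.

  The defender wins because the configuration of any \<open>v\<close> can be turned into that of any \<open>u\<close> in one
  round.  If \<open>u\<close> and \<open>v\<close> are disjoint, the surplus of \<open>v\<close> goes directly to
  \<open>u\<close>.  If they intersect, they are not adjacent, and the unit on \<open>v\<close> has to be relayed: \<open>v\<close> sends a
  share to each common neighbour, and at the same time the common neighbours send their old
  shares, one unit in all, to \<open>u\<close>.  In both cases the shares left over are those on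
  pairs that meet one of \<open>u\<close>, \<open>v\<close> in a single element and miss the other; they move
  along a regular bipartite graph (\<open>transfer_star\<close>).
\<close>

section \<open>Moves, transfers and strategies on a finite graph\<close>

lemma open_nbhd_finite_subset:
  assumes "pair_graph G"
  shows "finite (open_nbhd G x)" and "open_nbhd G x \<subseteq> pverts G"
proof -
  interpret pair_graph G by fact
  show "open_nbhd G x \<subseteq> pverts G"
    by (auto simp: open_nbhd_def dest: in_arcsD2)
  then show "finite (open_nbhd G x)"
    using pair_finite_verts finite_subset by blast
qed

lemma open_nbhd_sym:
  assumes "pair_graph G"
  shows "y \<in> open_nbhd G x \<longleftrightarrow> x \<in> open_nbhd G y"
proof -
  interpret pair_graph G by fact
  show ?thesis
    unfolding open_nbhd_def using arcs_symmetric by blast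
qed

lemma open_nbhd_outside:
  assumes "pair_graph G" and "x \<notin> pverts G"
  shows "open_nbhd G x = {}"
  using assms(2) open_nbhd_finite_subset(2)[OF assms(1)] open_nbhd_sym[OF assms(1)] by blast

lemma total_weight_apply_move:
  assumes G: "pair_graph G"
  shows "total_weight G (apply_move G w m) = total_weight G w"
proof -
  interpret pair_graph G by fact
  let ?V = "pverts G"
  have nbhd: "open_nbhd G x = {y \<in> ?V. y \<in> open_nbhd G x}" for x
    using open_nbhd_finite_subset(2)[OF G] by blast
  have "(\<Sum>x\<in>?V. \<Sum>y\<in>open_nbhd G x. m y x)
      = (\<Sum>x\<in>?V. \<Sum>y | y \<in> ?V \<and> y \<in> open_nbhd G x. m y x)"
    using nbhd by simp
  also have "\<dots> = (\<Sum>y\<in>?V. \<Sum>x | x \<in> ?V \<and> y \<in> open_nbhd G x. m y x)"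
    by (rule sum.swap_restrict) simp_all
  also have "\<dots> = (\<Sum>y\<in>?V. \<Sum>x | x \<in> ?V \<and> x \<in> open_nbhd G y. m y x)"
    using open_nbhd_sym[OF G] by simp
  also have "\<dots> = (\<Sum>y\<in>?V. \<Sum>x\<in>open_nbhd G y. m y x)"
    using nbhd by simp
  finally show ?thesis
    by (simp add: total_weight_def apply_move_def sum.distrib sum_subtractf)
qed

lemma total_weight_play:
  assumes "pair_graph G"
  shows "total_weight G (play G \<mu> w v i) = total_weight G w"
  by (induction i) (simp_all add: total_weight_apply_move[OF assms])

text \<open>
  A move is described only by the amounts \<open>f\<close> that leave and \<open>g\<close> that enter each vertex.  In this form
  moves can be superposed, and the weights available need to be compared with \<open>f\<close> only once, for
  the sum.
\<close>

definition transfer :: "'a pair_pre_digraph \<Rightarrow> ('a \<Rightarrow> real) \<Rightarrow> ('a \<Rightarrow> real) \<Rightarrow> bool" where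
  "transfer G f g \<longleftrightarrow> (\<exists>m.
     (\<forall>x\<in>pverts G. \<forall>y\<in>open_nbhd G x. m x y \<ge> 0) \<and>
     (\<forall>x\<in>pverts G. (\<Sum>y\<in>open_nbhd G x. m x y) = f x) \<and>
     (\<forall>x\<in>pverts G. (\<Sum>y\<in>open_nbhd G x. m y x) = g x))"

lemma transfer_add:
  assumes "transfer G f g" "transfer G f' g'"
  shows "transfer G (\<lambda>x. f x + f' x) (\<lambda>x. g x + g' x)"
proof -
  obtain m where m: "\<forall>x\<in>pverts G. \<forall>y\<in>open_nbhd G x. m x y \<ge> 0"
     "\<forall>x\<in>pverts G. (\<Sum>y\<in>open_nbhd G x. m x y) = f x"
     "\<forall>x\<in>pverts G. (\<Sum>y\<in>open_nbhd G x. m y x) = g x"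
    using assms(1) unfolding transfer_def by blast
  obtain m' where m': "\<forall>x\<in>pverts G. \<forall>y\<in>open_nbhd G x. m' x y \<ge> 0"
     "\<forall>x\<in>pverts G. (\<Sum>y\<in>open_nbhd G x. m' x y) = f' x"
     "\<forall>x\<in>pverts G. (\<Sum>y\<in>open_nbhd G x. m' y x) = g' x"
    using assms(2) unfolding transfer_def by blast
  show ?thesis
    unfolding transfer_def
    by (rule exI[of _ "\<lambda>x y. m x y + m' x y"]) (use m m' in \<open>simp add: sum.distrib\<close>)
qed

text \<open>
  If the arcs from \<open>X\<close> to \<open>Y\<close> are biregular, sending the same amount \<open>c\<close> along each of them takes equal
  amounts from the vertices of \<open>X\<close> and gives equal amounts to those of \<open>Y\<close>.  The cases \<open>X = {x}\<close> and \<open>Y = {y}\<close> distribute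
  and collect weight.
\<close>

lemma transfer_biregular:
  assumes G: "pair_graph G" and "c \<ge> 0"
    and k: "\<And>x. x \<in> X \<Longrightarrow> card (open_nbhd G x \<inter> Y) = k"
    and l: "\<And>y. y \<in> Y \<Longrightarrow> card (open_nbhd G y \<inter> X) = l"
  shows "transfer G (\<lambda>x. if x \<in> X then real k * c else 0) (\<lambda>y. if y \<in> Y then real l * c else 0)"
proof -
  let ?m = "\<lambda>x y. if x \<in> X \<and> y \<in> Y then c else 0"
  have indicator_sum: "(\<Sum>y\<in>open_nbhd G x. if y \<in> Z then c else 0)
      = real (card (open_nbhd G x \<inter> Z)) * c" for x Z
    by (simp add: sum.If_cases[OF open_nbhd_finite_subset(1)[OF G]] Int_def)
  show ?thesis
    unfolding transfer_def
    by (rule exI[of _ ?m]) (use \<open>c \<ge> 0\<close> k l indicator_sum in auto)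
qed

lemma legal_move_of_transfer:
  assumes G: "pair_graph G" and "transfer G f g"
    and le: "\<And>x. x \<in> pverts G \<Longrightarrow> f x \<le> w x"
    and upd: "\<And>x. x \<in> pverts G \<Longrightarrow> w' x = w x - f x + g x"
    and outside: "\<And>x. x \<notin> pverts G \<Longrightarrow> w' x = w x"
  shows "\<exists>m. legal_move G w m \<and> apply_move G w m = w'"
proof -
  obtain m where m: "\<forall>x\<in>pverts G. \<forall>y\<in>open_nbhd G x. m x y \<ge> 0"
     "\<forall>x\<in>pverts G. (\<Sum>y\<in>open_nbhd G x. m x y) = f x"
     "\<forall>x\<in>pverts G. (\<Sum>y\<in>open_nbhd G x. m y x) = g x"
    using \<open>transfer G f g\<close> unfolding transfer_def by blast
  have "legal_move G w m"
    using m le by (simp add: legal_move_def)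
  moreover have "apply_move G w m x = w' x" for x
    using m upd outside open_nbhd_outside[OF G]
    by (cases "x \<in> pverts G") (simp_all add: apply_move_def)
  ultimately show ?thesis by blast
qed

text \<open>
  The defender's strategy is positional: the current configuration is determined by the last attack,
  so the response to an attack depends only on the last two attacks.
\<close>

lemma eternally_fractionally_dominable_of_configurations:
  assumes v0: "v0 \<in> pverts G"
    and dom: "\<And>v. v \<in> pverts G \<Longrightarrow> fractional_dominating G (W v)"
    and guard: "\<And>v. v \<in> pverts G \<Longrightarrow> W v v \<ge> 1"
    and weight: "total_weight G (W v0) \<le> S"
    and move: "\<And>u v. u \<in> pverts G \<Longrightarrow> v \<in> pverts G \<Longrightarrow>
      \<exists>m. legal_move G (W v) m \<and> apply_move G (W v) m = W u"
  shows "eternally_fractionally_dominable G S"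
proof -
  define M where "M v u = (SOME m. legal_move G (W v) m \<and> apply_move G (W v) m = W u)" for v u
  have M: "legal_move G (W v) (M v u)" "apply_move G (W v) (M v u) = W u"
    if "u \<in> pverts G" "v \<in> pverts G" for u v
    using someI_ex[OF move[OF that]] by (simp_all add: M_def)
  \<comment> \<open>\<open>v0\<close> serves as the attack preceding the first one.\<close>
  define \<mu> where "\<mu> attacks = M (last (v0 # butlast attacks)) (last attacks)" for attacks
  have round: "legal_move G (play G \<mu> (W v0) v i) (\<mu> (map v [0..<Suc i])) \<and>
      play G \<mu> (W v0) v (Suc i) = W (v i)"
    if v: "\<forall>i. v i \<in> pverts G" for v i
  proof -
    have current: "last (v0 # map v [0..<i]) \<in> pverts G" for i
      using v v0 by (cases i) auto
    have response: "\<mu> (map v [0..<Suc i]) = M (last (v0 # map v [0..<i])) (v i)" for i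
      by (simp add: \<mu>_def butlast_append)
    have "play G \<mu> (W v0) v i = W (last (v0 # map v [0..<i]))" for i
    proof (induction i)
      case (Suc i)
      have "play G \<mu> (W v0) v (Suc i) = W (v i)"
        unfolding play.simps response Suc.IH using M(2) current v by blast
      then show ?case by simp
    qed simp
    then show ?thesis
      unfolding play.simps response using M current v by simp
  qed
  show ?thesis
    unfolding eternally_fractionally_dominable_def
    by (intro exI[of _ "W v0"] exI[of _ \<mu>] conjI allI impI)
      (simp_all add: dom[OF v0] weight round dom guard del: play.simps upt_Suc)
qed

section \<open>Counting pairs in the Kneser graph\<close>

abbreviation kneser_verts :: "nat \<Rightarrow> nat set set" where
  "kneser_verts n \<equiv> pverts (kneser_graph n 2)"

lemma pair_graph_kneser: "pair_graph (kneser_graph n 2)"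
  by (rule pair_graph_kneser_graph) simp

lemma finite_kneser_verts: "finite (kneser_verts n)"
proof -
  interpret pair_graph "kneser_graph n 2"
    by (rule pair_graph_kneser)
  show ?thesis by (rule pair_finite_verts)
qed

lemma open_nbhd_kneser:
  "v \<in> kneser_verts n \<Longrightarrow> open_nbhd (kneser_graph n 2) v = {q \<in> kneser_verts n. q \<inter> v = {}}"
  by (auto simp: open_nbhd_def kneser_graph_def)

lemma kneser_vertE:
  assumes "v \<in> kneser_verts n" and "a \<in> v"
  obtains b where "v = {a, b}" "a \<noteq> b" "a \<in> {1..n}" "b \<in> {1..n}"
proof -
  have v: "v \<subseteq> {1..n}" "card v = 2"
    using assms(1) by (auto simp: kneser_graph_def)
  obtain x y where "v = {x, y}" "x \<noteq> y"
    using v(2) by (auto simp: card_2_iff)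
  then show ?thesis
    using assms(2) v(1) that[of x] that[of y] by auto
qed

lemma kneser_vert_doubletonE:
  assumes "v \<in> kneser_verts n"
  obtains a b where "v = {a, b}" "a \<noteq> b" "a \<in> {1..n}" "b \<in> {1..n}"
proof -
  have "v \<noteq> {}"
    using assms by (auto simp: kneser_graph_def)
  then show ?thesis
    using that kneser_vertE[OF assms] by blast
qed

lemma doubleton_kneser_vert:
  "a \<in> {1..n} \<Longrightarrow> b \<in> {1..n} \<Longrightarrow> a \<noteq> b \<Longrightarrow> {a, b} \<in> kneser_verts n"
  by (auto simp: kneser_graph_def)

lemma kneser_vert_eq_iff:
  assumes "x \<in> kneser_verts n" "a \<noteq> b"
  shows "x = {a, b} \<longleftrightarrow> a \<in> x \<and> b \<in> x"
proof
  assume "a \<in> x \<and> b \<in> x"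
  then show "x = {a, b}"
    using assms by (auto elim!: kneser_vertE[of x n a])
qed simp

lemma kneser_vert_no_triple:
  assumes "x \<in> kneser_verts n" "p \<noteq> q" "p \<noteq> r" "q \<noteq> r"
  shows "\<not> (p \<in> x \<and> q \<in> x \<and> r \<in> x)"
proof
  assume "p \<in> x \<and> q \<in> x \<and> r \<in> x"
  moreover from this have "x = {p, q}"
    using kneser_vert_eq_iff[OF assms(1,2)] by blast
  ultimately show False
    using assms(3,4) by blast
qed

lemma card_pairs_avoiding:
  assumes "F \<subseteq> {1..n}"
  shows "card {q \<in> kneser_verts n. q \<inter> F = {}} = (n - card F) choose 2"
proof -
  have "{q \<in> kneser_verts n. q \<inter> F = {}} = {q. q \<subseteq> {1..n} - F \<and> card q = 2}"
    by (auto simp: kneser_graph_def)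
  moreover have "card ({1..n} - F) = n - card F"
    using assms by (simp add: card_Diff_subset finite_subset)
  ultimately show ?thesis
    using n_subsets[of "{1..n} - F" 2] by simp
qed

definition star :: "nat \<Rightarrow> nat \<Rightarrow> nat set \<Rightarrow> nat set set" where
  "star n a F = {q \<in> kneser_verts n. a \<in> q \<and> q \<inter> F = {}}"

lemma finite_star: "finite (star n a F)"
  using finite_kneser_verts by (simp add: star_def)

lemma card_star:
  assumes "a \<in> {1..n}" "F \<subseteq> {1..n}" "a \<notin> F"
  shows "card (star n a F) = n - card F - 1"
proof -
  have "finite F"
    using assms(2) finite_subset by blast
  have "star n a F = (\<lambda>y. {a, y}) ` ({1..n} - insert a F)"
  proof (rule set_eqI, rule iffI)
    fix q assume "q \<in> star n a F"
    then show "q \<in> (\<lambda>y. {a, y}) ` ({1..n} - insert a F)"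
      by (auto simp: star_def elim!: kneser_vertE[of q n a])
  next
    fix q assume "q \<in> (\<lambda>y. {a, y}) ` ({1..n} - insert a F)"
    then show "q \<in> star n a F"
      using assms doubleton_kneser_vert[of a n] by (auto simp: star_def)
  qed
  moreover have "inj_on (\<lambda>y. {a, y}) ({1..n} - insert a F)"
    by (auto simp: inj_on_def doubleton_eq_iff)
  ultimately have "card (star n a F) = card ({1..n} - insert a F)"
    by (simp add: card_image)
  also have "\<dots> = n - card (insert a F)"
    using assms \<open>finite F\<close> by (subst card_Diff_subset) auto
  also have "\<dots> = n - card F - 1"
    using assms \<open>finite F\<close> by simp
  finally show ?thesis .
qed

section \<open>The lower bound\<close>

text \<open>
  Double counting over the set \<open>M\<close> of pairs that share exactly one element with \<open>v\<close>: each demands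
  weight \<open>1\<close> in its closed neighbourhood, and a vertex other than \<open>v\<close> serves at most \<open>2 (n - 4)\<close> of them.
\<close>

lemma kneser_weight_lower_bound:
  assumes n: "n \<ge> 6" and v: "v \<in> kneser_verts n"
    and dom: "fractional_dominating (kneser_graph n 2) w" and guard: "w v \<ge> 1"
  shows "total_weight (kneser_graph n 2) w \<ge> 1 + (real n - 2) / (real n - 4)"
proof -
  let ?V = "kneser_verts n" and ?N = "closed_nbhd (kneser_graph n 2)"
  note G = pair_graph_kneser[of n]
  obtain a b where ab: "v = {a, b}" "a \<noteq> b" "a \<in> {1..n}" "b \<in> {1..n}"
    using v by (rule kneser_vert_doubletonE)
  define M where "M = star n a {b} \<union> star n b {a}"
  have M_verts: "M \<subseteq> ?V"
    by (auto simp: M_def star_def)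
  have "finite M"
    using finite_star by (simp add: M_def)
  have "star n a {b} \<inter> star n b {a} = {}"
    by (auto simp: star_def)
  then have "card M = 2 * (n - 2)"
    using ab by (simp add: M_def card_Un_disjoint finite_star card_star)
  have closed: "?N s = {x \<in> ?V. x \<in> ?N s}" if "s \<in> M" for s
    using that M_verts open_nbhd_finite_subset(2)[OF G] by (auto simp: closed_nbhd_def)
  have count: "card {s \<in> M. x \<in> ?N s} \<le> 2 * (n - 4)" if x: "x \<in> ?V" "x \<noteq> v" for x
  proof -
    have xn: "x \<subseteq> {1..n}" "card x = 2" "finite x"
      using x(1) finite_subset[of x "{1..n}"] by (auto simp: kneser_graph_def)
    have meets: "s = x \<or> s \<inter> x = {}" if "s \<in> M" "x \<in> ?N s" for s
      using that open_nbhd_kneser[of s n] M_verts by (auto simp: closed_nbhd_def)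
    \<comment> \<open>A pair \<open>x\<close> through \<open>c\<close> serves itself and the pairs in \<open>M\<close> through \<open>d\<close> that avoid \<open>x\<close>: \<open>n - 2\<close> pairs,
      which is at most \<open>2 (n - 4)\<close> because \<open>n \<ge> 6\<close>.\<close>
    have one_common: "card {s \<in> M. x \<in> ?N s} \<le> 2 * (n - 4)"
      if cd: "c \<in> x" "d \<notin> x" "v = {c, d}" for c d
    proof -
      have "{s \<in> M. x \<in> ?N s} \<subseteq> insert x (star n d x)"
        using meets cd ab by (auto simp: M_def star_def doubleton_eq_iff)
      then have "card {s \<in> M. x \<in> ?N s} \<le> card (insert x (star n d x))"
        by (intro card_mono) (auto simp: finite_star)
      also have "\<dots> \<le> Suc (card (star n d x))"
        by (simp add: card_insert_le_m1 card_insert_if finite_star)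
      also have "card (star n d x) = n - 3"
        using card_star[of d n x] ab xn cd by (auto simp: doubleton_eq_iff)
      finally show ?thesis
        using n by simp
    qed
    show ?thesis
    proof (cases "a \<in> x \<or> b \<in> x")
      case True
      then show ?thesis
        using one_common[of a b] one_common[of b a] ab x kneser_vert_eq_iff[OF x(1) ab(2)]
        by (auto simp: insert_commute)
    next
      case False
      have "{s \<in> M. x \<in> ?N s} \<subseteq> star n a (insert b x) \<union> star n b (insert a x)"
        using meets False by (fastforce simp: M_def star_def)
      then have "card {s \<in> M. x \<in> ?N s} \<le> card (star n a (insert b x) \<union> star n b (insert a x))"
        by (intro card_mono) (auto simp: finite_star)
      also have "\<dots> \<le> card (star n a (insert b x)) + card (star n b (insert a x))"
        by (rule card_Un_le)
      also have "\<dots> = 2 * (n - 4)"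
        using False ab xn by (simp add: card_star)
      finally show ?thesis .
    qed
  qed
  have "{s \<in> M. v \<in> ?N s} = {}"
    using ab M_verts by (auto simp: M_def star_def closed_nbhd_def open_nbhd_kneser)
  then have none: "card {s \<in> M. v \<in> ?N s} = 0"
    by (simp only: card.empty)
  have "2 * (real n - 2) = (\<Sum>s\<in>M. 1)"
    using \<open>card M = _\<close> n by simp
  also have "\<dots> \<le> (\<Sum>s\<in>M. \<Sum>x\<in>?N s. w x)"
    using dom M_verts by (intro sum_mono) (auto simp: fractional_dominating_def)
  also have "\<dots> = (\<Sum>s\<in>M. \<Sum>x | x \<in> ?V \<and> x \<in> ?N s. w x)"
    using closed by (intro sum.cong) auto
  also have "\<dots> = (\<Sum>x\<in>?V. \<Sum>s | s \<in> M \<and> x \<in> ?N s. w x)"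
    by (rule sum.swap_restrict) (use \<open>finite M\<close> finite_kneser_verts in auto)
  also have "\<dots> = (\<Sum>x\<in>?V. real (card {s \<in> M. x \<in> ?N s}) * w x)"
    by simp
  also have "\<dots> = (\<Sum>x\<in>?V - {v}. real (card {s \<in> M. x \<in> ?N s}) * w x)"
    using none v finite_kneser_verts by (subst sum.remove[of _ v]) auto
  also have "\<dots> \<le> (\<Sum>x\<in>?V - {v}. 2 * (real n - 4) * w x)"
  proof (intro sum_mono mult_right_mono)
    fix x assume "x \<in> ?V - {v}"
    then show "real (card {s \<in> M. x \<in> ?N s}) \<le> 2 * (real n - 4)"
      using of_nat_mono[OF count[of x], where 'a = real] n by (simp add: of_nat_diff)
    show "w x \<ge> 0"
      using \<open>x \<in> _\<close> dom by (simp add: fractional_dominating_def)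
  qed
  also have "\<dots> = 2 * (real n - 4) * (\<Sum>x\<in>?V - {v}. w x)"
    by (simp add: sum_distrib_left)
  finally have "(real n - 2) / (real n - 4) \<le> (\<Sum>x\<in>?V - {v}. w x)"
    using n by (simp add: field_simps)
  moreover have "total_weight (kneser_graph n 2) w = w v + (\<Sum>x\<in>?V - {v}. w x)"
    unfolding total_weight_def using v finite_kneser_verts by (rule sum.remove[rotated])
  ultimately show ?thesis
    using guard by simp
qed

lemma kneser_dominable_lower_bound:
  assumes n: "n \<ge> 6" and "eternally_fractionally_dominable (kneser_graph n 2) S"
  shows "S \<ge> 1 + (real n - 2) / (real n - 4)"
proof -
  let ?G = "kneser_graph n 2"
  obtain w \<mu> where "total_weight ?G w \<le> S"
    and win: "\<And>v i. \<forall>i. v i \<in> pverts ?G \<Longrightarrow>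
      fractional_dominating ?G (play ?G \<mu> w v (Suc i)) \<and> play ?G \<mu> w v (Suc i) (v i) \<ge> 1"
    using assms(2) unfolding eternally_fractionally_dominable_def by blast
  have v: "{1, 2} \<in> pverts ?G"
    using n by (intro doubleton_kneser_vert) auto
  have "total_weight ?G (play ?G \<mu> w (\<lambda>_. {1, 2}) (Suc 0)) \<ge> 1 + (real n - 2) / (real n - 4)"
    using win[of "\<lambda>_. {1, 2}" 0] v by (intro kneser_weight_lower_bound[OF n v]) auto
  then show ?thesis
    using \<open>total_weight ?G w \<le> S\<close> by (simp only: total_weight_play[OF pair_graph_kneser])
qed

section \<open>The defender's configurations\<close>

text \<open>The amount for which the pairs disjoint from two intersecting pairs carry exactly one unit.\<close>

definition share :: "nat \<Rightarrow> real" where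
  "share n = 2 / ((real n - 3) * (real n - 4))"

definition guard_config :: "nat \<Rightarrow> nat set \<Rightarrow> nat set \<Rightarrow> real" where
  "guard_config n v x =
     (if x = v then 1 else if x \<in> kneser_verts n \<and> x \<inter> v = {} then share n else 0)"

lemma share_nonneg: "n \<ge> 6 \<Longrightarrow> share n \<ge> 0"
  by (simp add: share_def)

lemma real_choose_2:
  assumes "m \<ge> 1"
  shows "real (m choose 2) = real m * (real m - 1) / 2"
proof -
  have "2 dvd m * (m - 1)"
    using assms by (cases "even m") auto
  then have "real (m choose 2) = real (m * (m - 1)) / 2"
    unfolding choose_two using real_of_nat_div by fastforce
  then show ?thesis
    using assms by (simp add: of_nat_diff)
qed

lemma choose_mult_share:
  assumes "n \<ge> 6"
  shows "real ((n - 3) choose 2) * share n = 1"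
proof -
  have "real ((n - 3) choose 2) = (real n - 3) * (real n - 4) / 2"
    using assms by (simp add: real_choose_2 of_nat_diff)
  then show ?thesis
    using assms by (simp add: share_def)
qed

lemma share_le_one:
  assumes "n \<ge> 6"
  shows "share n \<le> 1"
proof -
  have "(real n - 3) * (real n - 4) \<ge> 3 * 2"
    using assms by (intro mult_mono) auto
  then show ?thesis by (simp add: share_def)
qed

lemma total_weight_guard_config:
  assumes n: "n \<ge> 6" and v: "v \<in> kneser_verts n"
  shows "total_weight (kneser_graph n 2) (guard_config n v) = 1 + (real n - 2) / (real n - 4)"
proof -
  have v': "v \<subseteq> {1..n}" "card v = 2"
    using v by (auto simp: kneser_graph_def)
  then have "v \<noteq> {}" by auto
  have D: "{x \<in> kneser_verts n - {v}. x \<inter> v = {}} = {x \<in> kneser_verts n. x \<inter> v = {}}"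
    using \<open>v \<noteq> {}\<close> by auto
  have "total_weight (kneser_graph n 2) (guard_config n v)
      = 1 + (\<Sum>x\<in>kneser_verts n - {v}. guard_config n v x)"
    unfolding total_weight_def using v finite_kneser_verts
    by (subst sum.remove[of _ v]) (auto simp: guard_config_def)
  also have "(\<Sum>x\<in>kneser_verts n - {v}. guard_config n v x)
      = (\<Sum>x\<in>kneser_verts n - {v}. if x \<inter> v = {} then share n else 0)"
    by (intro sum.cong) (auto simp: guard_config_def)
  also have "\<dots> = (\<Sum>x\<in>{x \<in> kneser_verts n - {v}. x \<inter> v = {}}. share n)"
    by (rule sum.inter_filter[symmetric]) (use finite_kneser_verts in auto)
  also have "\<dots> = real ((n - 2) choose 2) * share n"
    unfolding D using card_pairs_avoiding[OF v'(1)] v'(2) by simp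
  also have "\<dots> = (real n - 2) / (real n - 4)"
    using n by (simp add: real_choose_2 share_def of_nat_diff divide_simps)
  finally show ?thesis .
qed

lemma card_Un_one_common:
  assumes "card u = 2" "card v = 2" "u \<noteq> v" "u \<inter> v \<noteq> {}"
  shows "card (u \<union> v) = 3"
proof -
  obtain a b c d where "u = {a, b}" "v = {c, d}" "a \<noteq> b" "c \<noteq> d"
    using assms(1,2) by (auto simp: card_2_iff)
  then show ?thesis
    using assms(3,4) by (auto simp: doubleton_eq_iff insert_commute card_insert_if)
qed

text \<open>
  The unit on \<open>v\<close> dominates \<open>v\<close> and its neighbours; every other vertex \<open>u\<close> meets \<open>v\<close> in one element, and
  the shares on the common neighbours of \<open>u\<close> and \<open>v\<close> add up to \<open>1\<close>.
\<close>

lemma guard_config_dominating: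
  assumes n: "n \<ge> 6" and v: "v \<in> kneser_verts n"
  shows "fractional_dominating (kneser_graph n 2) (guard_config n v)"
  unfolding fractional_dominating_def
proof (intro conjI ballI)
  show nonneg: "guard_config n v x \<ge> 0" for x
    using share_nonneg[OF n] by (simp add: guard_config_def)
  fix u assume u: "u \<in> kneser_verts n"
  let ?N = "closed_nbhd (kneser_graph n 2) u"
  have fin: "finite ?N"
    using open_nbhd_finite_subset(1)[OF pair_graph_kneser] by (simp add: closed_nbhd_def)
  show "1 \<le> (\<Sum>x\<in>?N. guard_config n v x)"
  proof (cases "u = v \<or> u \<inter> v = {}")
    case True
    then have "v \<in> ?N"
      using u v by (auto simp: closed_nbhd_def open_nbhd_kneser)
    then have "guard_config n v v \<le> (\<Sum>x\<in>?N. guard_config n v x)"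
      using fin nonneg by (intro member_le_sum) auto
    then show ?thesis by (simp add: guard_config_def)
  next
    case False
    let ?C = "{q \<in> kneser_verts n. q \<inter> (u \<union> v) = {}}"
    have "card (u \<union> v) = 3" "u \<union> v \<subseteq> {1..n}" "v \<noteq> {}"
      using u v False card_Un_one_common[of u v] by (auto simp: kneser_graph_def)
    then have "card ?C = (n - 3) choose 2"
      using card_pairs_avoiding[of "u \<union> v" n] by simp
    then have "1 = (\<Sum>x\<in>?C. share n)"
      using choose_mult_share[OF n] by simp
    also have "\<dots> = (\<Sum>x\<in>?C. guard_config n v x)"
      using \<open>v \<noteq> {}\<close> by (intro sum.cong) (auto simp: guard_config_def)
    also have "\<dots> \<le> (\<Sum>x\<in>?N. guard_config n v x)"
      using u nonneg fin by (intro sum_mono2) (auto simp: closed_nbhd_def open_nbhd_kneser)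
    finally show ?thesis .
  qed
qed

section \<open>Passing from one configuration to another\<close>

text \<open>
  Exchanging \<open>a\<close> for \<open>b\<close> in a pair \<open>{a, x}\<close> gives \<open>{b, x}\<close>, which is not adjacent to it; therefore the amount
  \<open>c\<close> on \<open>{a, x}\<close> is divided evenly among all \<open>{b, y}\<close> with \<open>y \<noteq> x\<close>.  For \<open>x, y\<close> outside \<open>F\<close>, \<open>a\<close> and \<open>b\<close> this
  is a regular bipartite graph of degree \<open>n - card F - 3\<close>, which is positive by assumption.
\<close>

lemma transfer_star:
  assumes "a \<in> {1..n}" "b \<in> {1..n}" "a \<noteq> b" "F \<subseteq> {1..n}" "a \<notin> F" "b \<notin> F"
    and "card F + 3 < n" and "c \<ge> 0"
  shows "transfer (kneser_graph n 2)
           (\<lambda>x. if x \<in> star n a (insert b F) then c else 0)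
           (\<lambda>x. if x \<in> star n b (insert a F) then c else 0)"
proof -
  have "finite F" using assms(4) finite_subset by blast
  have count: "card (open_nbhd (kneser_graph n 2) x \<inter> star n q (insert p F)) = n - card F - 3"
    if pq: "p \<in> {1..n}" "q \<in> {1..n}" "p \<noteq> q" "p \<notin> F" "q \<notin> F" and x: "x \<in> star n p (insert q F)"
    for p q x
  proof -
    obtain y where y: "x = {p, y}" "p \<noteq> y" "y \<in> {1..n}"
      using x kneser_vertE[of x n p] by (auto simp: star_def)
    have "open_nbhd (kneser_graph n 2) x \<inter> star n q (insert p F) = star n q (insert p (insert y F))"
      using x y by (auto simp: star_def open_nbhd_kneser)
    also have "card \<dots> = n - card F - 3"
      using x y pq \<open>finite F\<close> assms(4) by (subst card_star) (auto simp: star_def)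
    finally show ?thesis .
  qed
  have "transfer (kneser_graph n 2)
     (\<lambda>x. if x \<in> star n a (insert b F) then real (n - card F - 3) * (c / real (n - card F - 3)) else 0)
     (\<lambda>x. if x \<in> star n b (insert a F) then real (n - card F - 3) * (c / real (n - card F - 3)) else 0)"
    by (intro transfer_biregular pair_graph_kneser count) (use assms in auto)
  moreover have "real (n - card F - 3) * (c / real (n - card F - 3)) = c"
    using assms(7) by simp
  ultimately show ?thesis by (simp only:)
qed

text \<open>
  With \<open>v = {a, b}\<close> and \<open>u = {c, d}\<close>, the unit on \<open>v\<close> less the share that \<open>v\<close> keeps moves to \<open>u\<close>, the shares on the
  pairs \<open>{c, x}\<close> move to the pairs \<open>{a, y}\<close>, and those on the pairs \<open>{d, x}\<close> to the pairs \<open>{b, y}\<close>.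
\<close>

lemma guard_config_move_disjoint:
  assumes n: "n \<ge> 6" and u: "u \<in> kneser_verts n" and v: "v \<in> kneser_verts n" and "u \<inter> v = {}"
  shows "\<exists>m. legal_move (kneser_graph n 2) (guard_config n v) m \<and>
             apply_move (kneser_graph n 2) (guard_config n v) m = guard_config n u"
proof -
  let ?G = "kneser_graph n 2"
  note G = pair_graph_kneser[of n]
  obtain a b where ab: "v = {a, b}" "a \<noteq> b" "a \<in> {1..n}" "b \<in> {1..n}"
    using v by (rule kneser_vert_doubletonE)
  obtain c d where cd: "u = {c, d}" "c \<noteq> d" "c \<in> {1..n}" "d \<in> {1..n}"
    using u by (rule kneser_vert_doubletonE)
  have dist: "a \<noteq> c" "a \<noteq> d" "b \<noteq> c" "b \<noteq> d"
    using \<open>u \<inter> v = {}\<close> ab cd by auto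
  have share: "0 \<le> share n" "share n \<le> 1"
    using share_nonneg[OF n] share_le_one[OF n] by auto
  have direct: "transfer ?G (\<lambda>x. if x \<in> {v} then real 1 * (1 - share n) else 0)
      (\<lambda>x. if x \<in> {u} then real 1 * (1 - share n) else 0)"
    using u v \<open>u \<inter> v = {}\<close> share
    by (intro transfer_biregular G) (auto simp: open_nbhd_kneser Int_commute)
  have star1: "transfer ?G (\<lambda>x. if x \<in> star n c {a, b, d} then share n else 0)
      (\<lambda>x. if x \<in> star n a {c, b, d} then share n else 0)"
    using ab(2-4) cd(2-4) dist n share by (intro transfer_star) simp_all
  have star2: "transfer ?G (\<lambda>x. if x \<in> star n d {b, a, c} then share n else 0)
      (\<lambda>x. if x \<in> star n b {d, a, c} then share n else 0)"
    using ab(2-4) cd(2-4) dist n share by (intro transfer_star) simp_all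
  show ?thesis
  proof (rule legal_move_of_transfer[OF G transfer_add[OF direct transfer_add[OF star1 star2]]])
    fix x assume x: "x \<in> pverts ?G"
    have eqs: "x = v \<longleftrightarrow> a \<in> x \<and> b \<in> x" "x = u \<longleftrightarrow> c \<in> x \<and> d \<in> x"
      by (simp_all only: ab(1) cd(1) kneser_vert_eq_iff[OF x ab(2)] kneser_vert_eq_iff[OF x cd(2)])
    have disj: "x \<inter> v = {} \<longleftrightarrow> a \<notin> x \<and> b \<notin> x" "x \<inter> u = {} \<longleftrightarrow> c \<notin> x \<and> d \<notin> x"
      by (simp_all add: ab(1) cd(1))
    \<comment> \<open>Both weight functions and all amounts moved depend only on which of \<open>a\<close>, \<open>b\<close>, \<open>c\<close>, \<open>d\<close> lie in \<open>x\<close>,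
      so a finite case distinction settles the comparison.\<close>
    have mem: "x \<in> {v} \<longleftrightarrow> a \<in> x \<and> b \<in> x" "x \<in> {u} \<longleftrightarrow> c \<in> x \<and> d \<in> x"
      "x \<in> star n c {a, b, d} \<longleftrightarrow> c \<in> x \<and> a \<notin> x \<and> b \<notin> x \<and> d \<notin> x"
      "x \<in> star n d {b, a, c} \<longleftrightarrow> d \<in> x \<and> b \<notin> x \<and> a \<notin> x \<and> c \<notin> x"
      "x \<in> star n a {c, b, d} \<longleftrightarrow> a \<in> x \<and> c \<notin> x \<and> b \<notin> x \<and> d \<notin> x"
      "x \<in> star n b {d, a, c} \<longleftrightarrow> b \<in> x \<and> d \<notin> x \<and> a \<notin> x \<and> c \<notin> x"
      "guard_config n v x
        = (if a \<in> x \<and> b \<in> x then 1 else if a \<notin> x \<and> b \<notin> x then share n else 0)"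
      "guard_config n u x
        = (if c \<in> x \<and> d \<in> x then 1 else if c \<notin> x \<and> d \<notin> x then share n else 0)"
      by (simp_all add: star_def guard_config_def x eqs disj)
    have triples: "\<not> (a \<in> x \<and> b \<in> x \<and> c \<in> x)" "\<not> (a \<in> x \<and> b \<in> x \<and> d \<in> x)"
      "\<not> (a \<in> x \<and> c \<in> x \<and> d \<in> x)" "\<not> (b \<in> x \<and> c \<in> x \<and> d \<in> x)"
      by (intro kneser_vert_no_triple[OF x] ab(2) cd(2) dist)+
    show "(if x \<in> {v} then real 1 * (1 - share n) else 0) +
        ((if x \<in> star n c {a, b, d} then share n else 0) +
         (if x \<in> star n d {b, a, c} then share n else 0)) \<le> guard_config n v x"
      using triples share unfolding mem
      by (cases "a \<in> x"; cases "b \<in> x"; cases "c \<in> x"; cases "d \<in> x") simp_all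
    show "guard_config n u x = guard_config n v x -
        ((if x \<in> {v} then real 1 * (1 - share n) else 0) +
        ((if x \<in> star n c {a, b, d} then share n else 0) +
         (if x \<in> star n d {b, a, c} then share n else 0))) +
        ((if x \<in> {u} then real 1 * (1 - share n) else 0) +
        ((if x \<in> star n a {c, b, d} then share n else 0) +
         (if x \<in> star n b {d, a, c} then share n else 0)))"
      using triples unfolding mem
      by (cases "a \<in> x"; cases "b \<in> x"; cases "c \<in> x"; cases "d \<in> x") simp_all
  next
    fix x assume "x \<notin> pverts ?G"
    then show "guard_config n u x = guard_config n v x"
      using u v by (auto simp: guard_config_def)
  qed
qed

text \<open>
  With \<open>v = {a, b}\<close> and \<open>u = {a, c}\<close>, the unit on \<open>v\<close> reaches \<open>u\<close> through the set \<open>C\<close> of common neighbours.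
  Within one round weight travels only one step, and this works because the vertices of \<open>C\<close>
  already hold a unit together: they give it to \<open>u\<close> and are refilled from \<open>v\<close>.  The shares on
  the pairs \<open>{c, x}\<close> move to the pairs \<open>{b, y}\<close>.
\<close>

lemma guard_config_move_meeting:
  assumes n: "n \<ge> 6" and u: "u \<in> kneser_verts n" and v: "v \<in> kneser_verts n"
    and "u \<noteq> v" "u \<inter> v \<noteq> {}"
  shows "\<exists>m. legal_move (kneser_graph n 2) (guard_config n v) m \<and>
             apply_move (kneser_graph n 2) (guard_config n v) m = guard_config n u"
proof -
  let ?G = "kneser_graph n 2"
  note G = pair_graph_kneser[of n]
  obtain a where "a \<in> u" "a \<in> v"
    using \<open>u \<inter> v \<noteq> {}\<close> by blast
  then obtain b c where ab: "v = {a, b}" "a \<noteq> b" "a \<in> {1..n}" "b \<in> {1..n}"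
    and ac: "u = {a, c}" "a \<noteq> c" "c \<in> {1..n}"
    using u v kneser_vertE by metis
  have "b \<noteq> c" using \<open>u \<noteq> v\<close> ab ac by auto
  define C where "C = {q \<in> kneser_verts n. q \<inter> (u \<union> v) = {}}"
  have "card C = (n - 3) choose 2"
    unfolding C_def using card_pairs_avoiding[of "u \<union> v" n] u v
      card_Un_one_common[OF _ _ \<open>u \<noteq> v\<close> \<open>u \<inter> v \<noteq> {}\<close>] by (auto simp: kneser_graph_def)
  then have unit: "real (card C) * share n = 1"
    using choose_mult_share[OF n] by simp
  have share: "0 \<le> share n"
    using share_nonneg[OF n] .
  have C_nbhd: "open_nbhd ?G u \<inter> C = C" "open_nbhd ?G v \<inter> C = C"
    using u v by (auto simp: C_def open_nbhd_kneser)
  have nbhd_C: "open_nbhd ?G x \<inter> {u} = {u}" "open_nbhd ?G x \<inter> {v} = {v}" if "x \<in> C" for x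
    using u v that by (auto simp: C_def open_nbhd_kneser)
  have to_C: "transfer ?G (\<lambda>x. if x \<in> {v} then real (card C) * share n else 0)
      (\<lambda>x. if x \<in> C then real 1 * share n else 0)"
    using C_nbhd nbhd_C share by (intro transfer_biregular G) auto
  have from_C: "transfer ?G (\<lambda>x. if x \<in> C then real 1 * share n else 0)
      (\<lambda>x. if x \<in> {u} then real (card C) * share n else 0)"
    using C_nbhd nbhd_C share by (intro transfer_biregular G) auto
  have star: "transfer ?G (\<lambda>x. if x \<in> star n c {b, a} then share n else 0)
      (\<lambda>x. if x \<in> star n b {c, a} then share n else 0)"
    using ab ac \<open>b \<noteq> c\<close> n share by (intro transfer_star) auto
  show ?thesis
  proof (rule legal_move_of_transfer[OF G
        transfer_add[OF to_C transfer_add[OF from_C star], unfolded unit]])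
    fix x assume x: "x \<in> pverts ?G"
    have eqs: "x = v \<longleftrightarrow> a \<in> x \<and> b \<in> x" "x = u \<longleftrightarrow> a \<in> x \<and> c \<in> x"
      using kneser_vert_eq_iff[OF x] ab ac by auto
    have disj: "x \<inter> v = {} \<longleftrightarrow> a \<notin> x \<and> b \<notin> x" "x \<inter> u = {} \<longleftrightarrow> a \<notin> x \<and> c \<notin> x"
      "x \<inter> (u \<union> v) = {} \<longleftrightarrow> a \<notin> x \<and> b \<notin> x \<and> c \<notin> x"
      using ab ac by auto
    have triple: "\<not> (a \<in> x \<and> b \<in> x \<and> c \<in> x)"
      by (intro kneser_vert_no_triple[OF x] ab(2) ac(2) \<open>b \<noteq> c\<close>)
    show "(if x \<in> {v} then 1 else 0) + ((if x \<in> C then real 1 * share n else 0) +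
         (if x \<in> star n c {b, a} then share n else 0)) \<le> guard_config n v x"
      using x triple share by (auto simp: guard_config_def star_def C_def eqs disj)
    show "guard_config n u x = guard_config n v x -
        ((if x \<in> {v} then 1 else 0) + ((if x \<in> C then real 1 * share n else 0) +
         (if x \<in> star n c {b, a} then share n else 0))) +
        ((if x \<in> C then real 1 * share n else 0) + ((if x \<in> {u} then 1 else 0) +
         (if x \<in> star n b {c, a} then share n else 0)))"
      using x triple by (auto simp: guard_config_def star_def C_def eqs disj)
  next
    fix x assume "x \<notin> pverts ?G"
    then show "guard_config n u x = guard_config n v x"
      using u v by (auto simp: guard_config_def)
  qed
qed

theorem theorem4p14:
  fixes n :: nat
  assumes "n \<ge> 6"
  shows "fractional_eternal_domination_number (kneser_graph n 2) = 1 + (real n - 2) / (real n - 4) \<and>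
         1 + (real n - 2) / (real n - 4) = 2 + 2 / (real n - 4) \<and>
         2 + 2 / (real n - 4) = (2 * real n - 6) / (real n - 4)"
proof -
  let ?G = "kneser_graph n 2" and ?S = "1 + (real n - 2) / (real n - 4)"
  have v0: "{1, 2} \<in> pverts ?G"
    using assms by (intro doubleton_kneser_vert) auto
  have "eternally_fractionally_dominable ?G ?S"
  proof (rule eternally_fractionally_dominable_of_configurations[OF v0])
    show "fractional_dominating ?G (guard_config n v)" if "v \<in> pverts ?G" for v
      using guard_config_dominating[OF assms that] .
    show "total_weight ?G (guard_config n {1, 2}) \<le> ?S"
      using total_weight_guard_config[OF assms v0] by simp
    show "\<exists>m. legal_move ?G (guard_config n v) m \<and>
        apply_move ?G (guard_config n v) m = guard_config n u"
      if "u \<in> pverts ?G" "v \<in> pverts ?G" for u v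
    proof (cases "u = v")
      case True
      have "legal_move ?G (guard_config n v) (\<lambda>_ _. 0)"
        using guard_config_dominating[OF assms that(2)]
        by (simp add: legal_move_def fractional_dominating_def)
      then show ?thesis
        using True by (intro exI[of _ "\<lambda>_ _. 0"]) (auto simp: apply_move_def)
    next
      case False
      then show ?thesis
        using guard_config_move_disjoint[OF assms that] guard_config_move_meeting[OF assms that]
        by blast
    qed
  qed (simp add: guard_config_def)
  then have "Inf {S. eternally_fractionally_dominable ?G S} = ?S"
    using kneser_dominable_lower_bound[OF assms] by (intro cInf_eq_minimum) auto
  then show ?thesis
    using assms by (simp add: fractional_eternal_domination_number_def field_simps)
qed

end
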